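(* Let $p$ be a prime, let $b$ be a nonnegative integer, and let $m\ge 1$ be an integer. Let $f:\mathbb{N}\to\mathbb{N}$ satisfy $f(0)=0$ and $f(x)=0$ for all $x>m$. Then for all integers $n\ge 0$, $$c_f(n+mp^b)\equiv f(1)\,c_f(n+(m-1)p^b)+f(2)\,c_f(n+(m-2)p^b)+\cdots+f(m)\,c_f(n)\pmod{p}.$$
   Context: $\mathbb{N}=\{0,1,2,\dots\}$. For a function $f:\mathbb{N}\to\mathbb{N}$ and integers $k,n\ge 0$, $\binom{k}{n}_{f}$ denotes the coefficient of $x^n$ in the formal power series $\bigl(\sum_{s\in\mathbb{N}} f(s)x^s\bigr)^k$; this is the number of $f$-weighted integer compositions of $n$ with $k$ parts (tuples of $k$ nonnegative integers summing to $n$, where each part of size $s$ carries one of $f(s)$ colors). When $f(0)=0$, $c_f(n)=\sum_{k\ge 0}\binom{k}{n}_f$ is the (finite) number of $f$-weighted integer compositions of $n$ with arbitrarily many parts; in particular $c_f(0)=1$. *)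

theory Defs
  imports
    "HOL-Computational_Algebra.Computational_Algebra"
    "HOL-Number_Theory.Cong"
    "HOL-Library.Groups_Big_Fun"
begin

definition weighted_binomial :: "(nat \<Rightarrow> nat) \<Rightarrow> nat \<Rightarrow> nat \<Rightarrow> nat" where
  "weighted_binomial f k n = fps_nth (Abs_fps f ^ k) n"

(* Sum_any is the sum over all natural numbers k of a finitely supported function
   (and 0 if the support is infinite). For f 0 = 0 the support is finite; see below. *)
definition weighted_compositions :: "(nat \<Rightarrow> nat) \<Rightarrow> nat \<Rightarrow> nat" where
  "weighted_compositions f n = Sum_any (\<lambda>k. weighted_binomial f k n)"

lemma weighted_binomial_eq_0:
  assumes "f 0 = 0" "n < k"
  shows "weighted_binomial f k n = 0"
  using assms by (simp add: weighted_binomial_def startsby_zero_power_prefix)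

lemma finite_support_weighted_binomial:
  assumes "f 0 = 0"
  shows "finite {k. weighted_binomial f k n \<noteq> 0}"
proof (rule finite_subset)
  show "{k. weighted_binomial f k n \<noteq> 0} \<subseteq> {..n}"
    using weighted_binomial_eq_0[of f n] assms by (auto simp: not_less[symmetric])
qed simp

lemma weighted_compositions_0:
  assumes "f 0 = 0"
  shows "weighted_compositions f 0 = 1"
proof -
  have "Sum_any (\<lambda>k. weighted_binomial f k 0) = (\<Sum>k\<in>{0}. weighted_binomial f k 0)"
    using weighted_binomial_eq_0[of f 0] assms
    by (intro Sum_any.expand_superset) (auto intro: ccontr)
  then show ?thesis
    by (simp add: weighted_compositions_def weighted_binomial_def)
qed

end

theory Submission
  imports Defs
begin

text \<open>
  Put \<open>F(x) = \<Sum>s. f(s) x\<^sup>s\<close>, \<open>G = 1 - F\<close> and \<open>q = p\<^sup>b\<close>. The generating function of \<open>c\<^sub>f\<close> is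
  \<open>C = 1 / G\<close>. By the Frobenius and Fermat congruences, \<open>G(x\<^sup>q) \<equiv> G(x)\<^sup>q\<close> modulo \<open>p\<close>, so
  \<open>C(x) G(x\<^sup>q) \<equiv> G(x)\<^bsup>q-1\<^esup>\<close>, a polynomial of degree less than \<open>m q\<close>. The claim is the vanishing
  modulo \<open>p\<close> of the coefficient of \<open>x\<^bsup>n+mq\<^esup>\<close>.
\<close>

text \<open>In the binomial expansion every coefficient \<open>p choose k\<close> with
  \<open>0 < k < p\<close> is a multiple of \<open>p\<close>. A general commutative ring is used
  because both integers and integer polynomials are needed later.\<close>

lemma prime_dvd_power_add_diff:
  fixes x y :: "'a::comm_ring_1"
  assumes "prime p"
  shows "of_nat p dvd (x + y) ^ p - (x ^ p + y ^ p)"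
proof -
  have p: "p > 0" using assms by (rule prime_gt_0_nat)
  let ?t = "\<lambda>k. of_nat (p choose k) * x ^ k * y ^ (p - k)"
  have eq: "{..p} = insert 0 (insert p {0<..<p})"
    using p by auto
  have "(x + y) ^ p = (\<Sum>k\<le>p. ?t k)"
    by (rule binomial_ring)
  also have "\<dots> = y ^ p + (x ^ p + (\<Sum>k\<in>{0<..<p}. ?t k))"
    unfolding eq using p by simp
  finally have "(x + y) ^ p - (x ^ p + y ^ p) = (\<Sum>k\<in>{0<..<p}. ?t k)"
    by simp
  moreover have "of_nat p dvd (of_nat (p choose k) :: 'a)" if "k \<in> {0<..<p}" for k
  proof -
    have "p dvd (p choose k)"
      using that assms by (intro dvd_choose_prime) auto
    then show ?thesis by (elim dvdE) simp
  qed
  ultimately show ?thesis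
    by (auto intro!: dvd_sum dvd_mult2)
qed

lemma dvd_diff_power:
  fixes x y d :: "'a::comm_ring_1"
  assumes "d dvd x - y"
  shows "d dvd x ^ n - y ^ n"
  using assms by (simp add: power_diff_sumr2)

lemma prime_dvd_prime_power_add_diff:
  fixes x y :: "'a::comm_ring_1"
  assumes "prime p"
  shows "of_nat p dvd (x + y) ^ (p ^ b) - (x ^ (p ^ b) + y ^ (p ^ b))"
proof (induction b)
  case (Suc b)
  let ?u = "x ^ (p ^ b)" and ?v = "y ^ (p ^ b)"
  have "of_nat p dvd ((x + y) ^ (p ^ b)) ^ p - (?u + ?v) ^ p"
    using Suc by (rule dvd_diff_power)
  from dvd_add[OF this prime_dvd_power_add_diff[OF assms, of ?u ?v]]
  show ?case unfolding power_Suc2 power_mult by (simp add: algebra_simps)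
qed simp

lemma prime_dvd_prime_power_sum_diff:
  fixes a :: "'i \<Rightarrow> 'a::comm_ring_1"
  assumes "prime p" "finite A"
  shows "of_nat p dvd (\<Sum>i\<in>A. a i) ^ (p ^ b) - (\<Sum>i\<in>A. a i ^ (p ^ b))"
  using assms(2)
proof induction
  case empty
  then show ?case using prime_gt_0_nat[OF assms(1)] by (simp add: power_0_left)
next
  case (insert i A)
  from dvd_add[OF prime_dvd_prime_power_add_diff[OF assms(1), of "a i" "\<Sum>i\<in>A. a i" b] insert.IH]
  show ?case using insert.hyps by (simp add: algebra_simps)
qed

text \<open>Fermat's congruence for \<open>k \<ge> 0\<close> is the Frobenius congruence for a sum of \<open>k\<close> ones.\<close>

lemma prime_dvd_int_prime_power_diff:
  fixes a :: int
  assumes "prime p"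
  shows "int p dvd a ^ (p ^ b) - a"
proof -
  have nat: "int p dvd int k ^ (p ^ b) - int k" for k
    using prime_dvd_prime_power_sum_diff[OF assms, of "{..<k}" "\<lambda>_. 1 :: int" b] by simp
  show ?thesis
  proof (cases a rule: int_cases2)
    case (nonneg k)
    then show ?thesis using nat by simp
  next
    case (nonpos k)
    \<comment> \<open>Frobenius for the vanishing sum \<open>int k + a\<close> shows that the powers
      of \<open>a\<close> and \<open>int k\<close> are opposite modulo \<open>p\<close>, without a
      case split on the parity of \<open>p\<close>.\<close>
    have "int p dvd - (int k ^ (p ^ b) + a ^ (p ^ b))"
      using prime_dvd_prime_power_add_diff[OF assms, of "int k" a b] prime_gt_0_nat[OF assms] nonpos
      by (simp add: power_0_left)
    then have "int p dvd int k ^ (p ^ b) + a ^ (p ^ b)"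
      by (simp only: dvd_minus_iff)
    from dvd_diff[OF this nat[of k]] show ?thesis
      using nonpos by simp
  qed
qed

lemma of_nat_dvd_poly_iff:
  fixes P :: "int poly"
  shows "of_nat d dvd P \<longleftrightarrow> (\<forall>i. int d dvd coeff P i)"
  using const_poly_dvd_iff[of "int d" P] by (simp add: of_nat_poly)

text \<open>Frobenius moves the exponent onto the single monomials; Fermat then replaces each
  coefficient \<open>g j ^ (p ^ b)\<close> by \<open>g j\<close>.\<close>

lemma prime_dvd_poly_prime_power_diff:
  fixes g :: "nat \<Rightarrow> int"
  assumes "prime p"
  shows "of_nat p dvd (\<Sum>j\<le>m. monom (g j) j) ^ (p ^ b) - (\<Sum>j\<le>m. monom (g j) (j * p ^ b))"
proof -
  have "of_nat p dvd (\<Sum>j\<le>m. monom (g j) j ^ (p ^ b)) - (\<Sum>j\<le>m. monom (g j) (j * p ^ b))"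
    unfolding sum_subtractf[symmetric] monom_power diff_monom
    using prime_dvd_int_prime_power_diff[OF assms]
    by (intro dvd_sum) (simp add: of_nat_dvd_poly_iff)
  from dvd_add[OF prime_dvd_prime_power_sum_diff[OF assms, of "{..m}" "\<lambda>j. monom (g j) j" b] this]
  show ?thesis by simp
qed

lemma fps_nth_power_int:
  "fps_nth (Abs_fps (\<lambda>s. int (f s)) ^ k) n = int (fps_nth (Abs_fps f ^ k) n)"
  by (induction k arbitrary: n) (simp_all add: fps_mult_nth)

text \<open>The free bound \<open>N\<close> lets one partial sum of the geometric series serve all
  coefficients up to \<open>N\<close>.\<close>

lemma weighted_compositions_eq_sum:
  assumes "f 0 = 0" "n \<le> N"
  shows "weighted_compositions f n = (\<Sum>k\<le>N. weighted_binomial f k n)"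
  unfolding weighted_compositions_def
  using weighted_binomial_eq_0[of f n] assms
  by (intro Sum_any.expand_superset) (auto intro: ccontr simp: not_le)

text \<open>Up to degree \<open>n\<close> the generating function agrees with a finite geometric
  sum. Multiplied by \<open>1 - ?F\<close>, this telescopes to \<open>1 - ?F ^ Suc n\<close>, and
  \<open>?F ^ Suc n\<close> starts beyond degree \<open>n\<close> since
  \<open>f 0 = 0\<close>.\<close>

lemma weighted_compositions_fps:
  assumes "f 0 = 0"
  shows "Abs_fps (\<lambda>n. int (weighted_compositions f n)) * (1 - Abs_fps (\<lambda>s. int (f s))) = 1"
    (is "?C * (1 - ?F) = 1")
proof (rule fps_ext)
  fix n
  have "fps_nth ?C i = fps_nth (\<Sum>k<Suc n. ?F ^ k) i" if "i \<le> n" for i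
    using weighted_compositions_eq_sum[of f, OF assms that]
    by (simp add: weighted_binomial_def fps_nth_power_int fps_sum_nth lessThan_Suc_atMost del: sum.lessThan_Suc)
  then have "fps_nth (?C * (1 - ?F)) n = fps_nth ((\<Sum>k<Suc n. ?F ^ k) * (1 - ?F)) n"
    unfolding fps_mult_nth by (intro sum.cong) auto
  also have "(\<Sum>k<Suc n. ?F ^ k) * (1 - ?F) = 1 - ?F ^ Suc n"
    by (metis mult.commute one_diff_power_eq)
  also have "fps_nth \<dots> n = fps_nth 1 n"
    using startsby_zero_power_prefix[of ?F "Suc n"] assms by simp
  finally show "fps_nth (?C * (1 - ?F)) n = fps_nth 1 n" .
qed

theorem theorem27:
  fixes p b m n :: nat and f :: "nat \<Rightarrow> nat"
  assumes "prime p" and "m \<ge> 1"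
    and "f 0 = 0" and "\<And>x. x > m \<Longrightarrow> f x = 0"
  shows "[weighted_compositions f (n + m * p ^ b) =
          (\<Sum>j = 1..m. f j * weighted_compositions f (n + (m - j) * p ^ b))] (mod p)"
proof -
  define q where "q = p ^ b"
  define N where "N = n + m * q"
  define c where "c = (\<lambda>k. int (weighted_compositions f k))"
  \<comment> \<open>\<open>g\<close> lists the coefficients of 1 - F; thus \<open>D\<close> is
    \<open>G\<close> with x^q substituted for x. Taking \<open>G\<close> as a polynomial makes its
    degree available.\<close>
  define g where "g = (\<lambda>j. if j = 0 then 1 else - int (f j))"
  define G where "G = (\<Sum>j\<le>m. monom (g j) j)"
  define D where "D = (\<Sum>j\<le>m. monom (g j) (j * q))"
  have q: "q > 0"
    using prime_gt_0_nat[OF assms(1)] by (simp add: q_def)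
  have "of_nat p dvd G ^ q - D"
    unfolding G_def D_def q_def by (rule prime_dvd_poly_prime_power_diff[OF assms(1)])
  then obtain H where "G ^ q - D = of_nat p * H" ..
  then have D: "D = G ^ q - of_nat p * H"
    by (simp add: algebra_simps)
  have "fps_of_poly G = 1 - Abs_fps (\<lambda>s. int (f s))"
  proof (rule fps_ext)
    fix i
    show "fps_nth (fps_of_poly G) i = fps_nth (1 - Abs_fps (\<lambda>s. int (f s))) i"
      using assms(3,4) by (cases "i \<le> m") (auto simp: G_def g_def coeff_sum)
  qed
  then have CG: "Abs_fps c * fps_of_poly G = 1"
    using weighted_compositions_fps[of f] assms(3) by (simp add: c_def)
  \<comment> \<open>As \<open>q > 0\<close>, one factor of the power can be split off and cancelled
    against \<open>Abs_fps c\<close>.\<close>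
  have "Abs_fps c * fps_of_poly G ^ q = fps_of_poly G ^ (q - 1)"
    using q CG by (simp add: power_eq_if mult.assoc[symmetric])
  moreover have "fps_of_poly (of_nat p) = (of_nat p :: int fps)"
    by (simp add: of_nat_poly fps_of_poly_const fps_of_nat)
  ultimately have "Abs_fps c * fps_of_poly D =
      fps_of_poly (G ^ (q - 1)) - of_nat p * (Abs_fps c * fps_of_poly H)"
    by (simp add: D fps_of_poly_diff fps_of_poly_mult fps_of_poly_power algebra_simps)
  \<comment> \<open>The degree is at most \<open>m * (q - 1)\<close>, which is below
    \<open>m * q\<close> because \<open>m \<ge> 1\<close>. So at \<open>N\<close> only the multiple
    of \<open>p\<close> survives.\<close>
  moreover have "coeff (G ^ (q - 1)) N = 0"
  proof (rule coeff_eq_0)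
    have "degree G \<le> m"
      unfolding G_def by (intro degree_sum_le) (auto intro: order.trans[OF degree_monom_le])
    then have "degree (G ^ (q - 1)) \<le> m * (q - 1)"
      using degree_power_le[of G "q - 1"] by (meson mult_le_mono1 order.trans)
    also have "\<dots> < N"
      using assms(2) q by (simp add: N_def trans_less_add2)
    finally show "degree (G ^ (q - 1)) < N" .
  qed
  ultimately have "int p dvd fps_nth (Abs_fps c * fps_of_poly D) N"
    by (simp add: fps_of_nat[symmetric])
  also have "fps_nth (Abs_fps c * fps_of_poly D) N = (\<Sum>j\<le>m. g j * c (n + (m - j) * q))"
  proof -
    have "Abs_fps c * fps_of_poly D = (\<Sum>j\<le>m. fps_const (g j) * (Abs_fps c * fps_X ^ (j * q)))"
      by (simp add: D_def fps_of_poly_sum fps_of_poly_monom sum_distrib_left mult_ac)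
    also have "fps_nth \<dots> N = (\<Sum>j\<le>m. g j * c (N - j * q))"
      unfolding fps_sum_nth
    proof (intro sum.cong)
      fix j assume "j \<in> {..m}"
      then have "j * q \<le> N" by (simp add: N_def trans_le_add2)
      then show "fps_nth (fps_const (g j) * (Abs_fps c * fps_X ^ (j * q))) N = g j * c (N - j * q)"
        by (simp add: fps_X_power_mult_right_nth)
    qed simp
    also have "\<dots> = (\<Sum>j\<le>m. g j * c (n + (m - j) * q))"
      by (intro sum.cong) (auto simp: N_def diff_mult_distrib)
    finally show ?thesis .
  qed
  \<comment> \<open>The term \<open>j = 0\<close> has coefficient 1 and gives \<open>c N\<close>;
    the others carry the minus sign of \<open>g\<close>.\<close>
  also have "\<dots> = c N - (\<Sum>j=1..m. int (f j) * c (n + (m - j) * q))"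
    by (simp add: atMost_atLeast0 sum.atLeast_Suc_atMost g_def N_def sum_negf[symmetric])
  finally have "[c N = (\<Sum>j=1..m. int (f j) * c (n + (m - j) * q))] (mod int p)"
    by (simp add: cong_iff_dvd_diff)
  then show ?thesis
    unfolding cong_int_iff[symmetric] by (simp add: c_def N_def q_def)
qed

end
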